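(* Let $X_1,X_2,\dots$ be i.i.d. with common density $f(x;\theta)$, $\theta=(\theta_1,\dots,\theta_d)'$, and let $\{\hat\theta_n\}$ be an efficient sequence of maximum likelihood estimators, i.e. $\sqrt n(\hat\theta_n-\theta)\overset{d}{\rightarrow}N(0,\mathfrak{F}^{-1}(\theta))$ whatever is the true value of $\theta$, where $\mathfrak{F}(\theta)=-\mathrm{E}_\theta\left[\frac{\partial^2}{\partial\theta\partial\theta'}\log f(X_1;\theta)\right]$ is the Fisher information matrix. Let $c=(c_1,\dots,c_d)'$ be a constant vector, let $(a_{nj})$ be $d$-vectors with positive components satisfying $\max_{1\le j\le d}a_{nj}\rightarrow0$ and $\sqrt n\min_{1\le j\le d}a_{nj}\rightarrow\infty$ as $n\rightarrow\infty$, and let $\tilde\theta_n(c)$ be the oracle Hodges' estimator derived from $\hat\theta_n$ (defined in the context, with $V=\mathfrak{F}(\theta)$). Then, whatever is the true value of $\theta$: for any $b\subset\{1,\dots,d\}$ with complement $\bar b$, $\theta_{\bar b}=c_{\bar b}$ implies $$\lim_{n\rightarrow\infty}\Pr\nolimits_\theta(\tilde\theta_{n,\bar b}(c)=\theta_{\bar b})=1,$$ and $$\sqrt n(\tilde\theta_n(c)-\theta)\overset{d}{\rightarrow}N\left(0,\begin{pmatrix}\mathfrak{F}_{b(\theta)b'(\theta)}^{-1}(\theta)&0\\0&0\end{pmatrix}\right),$$ where components are arranged with the indices in $b(\theta)=\{j:\theta_j\neq c_j\}$ first and those in $\bar b(\theta)=\{1,\dots,d\}\setminus b(\theta)$ last,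 and $\mathfrak{F}_{b(\theta)b'(\theta)}(\theta)$ is the submatrix of $\mathfrak{F}(\theta)$ with rows and columns in $b(\theta)$.
   Context: Standing assumptions: $\mathfrak{F}(\theta)$ is invertible and $\mathfrak{F}^{-1}(\theta)$ is a continuous function of $\theta$. Put $V=\mathfrak{F}(\theta)$; $\hat V^{-1}$ denotes any consistent estimator of $V^{-1}$, and $\hat V$ its inverse. For $b\subset\{1,\dots,d\}$ with complement $\bar b$, vectors are rearranged as $\theta=(\theta_b',\theta_{\bar b}')'$, $\hat\theta_n=(\hat\theta_{n,b}',\hat\theta_{n,\bar b}')'$, and $\hat V=\begin{pmatrix}\hat V_{bb}&\hat V_{b\bar b}\\\hat V_{\bar bb}&\hat V_{\bar b\bar b}\end{pmatrix}$ is partitioned correspondingly. For $\emptyset\neq b\neq\{1,\dots,d\}$ put $\check\theta_{n,b}=\hat\theta_{n,b}+\hat V_{bb}^{-1}\hat V_{b\bar b}(\hat\theta_{n,\bar b}-c_{\bar b})$. Oracle Hodges' estimator: let $b_n(c)=\{j:|\hat\theta_{nj}-c_j|>a_{nj}\}$ and $\bar b_n(c)=\{j:|\hat\theta_{nj}-c_j|\le a_{nj}\}$. Then $\tilde\theta_n(c)=\hat\theta_n$ if $b_n(c)=\{1,\dots,d\}$; $\tilde\theta_n(c)=c$ if $b_n(c)=\emptyset$; otherwise the subvector of $\tilde\theta_n(c)$ with indices in $b_n(c)$ is $\check\theta_{n,b}$ evaluated at $b=b_n(c)$ and the subvector with indices in $\bar b_n(c)$ is $c_{\bar b_n(c)}$.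 $\tilde\theta_{n,\bar b}(c)$ denotes the subvector of $\tilde\theta_n(c)$ with indices in $\bar b$. If $b(\theta)=\emptyset$ the limit law is the point mass at $0$. $\Pr_\theta$ is the probability under true parameter $\theta$; $\overset{d}{\rightarrow}$ is convergence in distribution. *)

theory Defs
  imports "HOL-Probability.Probability"
begin

text \<open>
  Vectors of $\mathbb{R}^d$ and $d \times d$ matrices are \<^typ>\<open>real ^ 'd\<close> and
  \<^typ>\<open>real ^ 'd ^ 'd\<close>, with \<^typ>\<open>'d\<close> an arbitrary finite index type.
  Subvectors and blocks with respect to a set \<open>b\<close> of indices keep the original index positions
  and are padded with zeros outside. No rearrangement of the components is needed, and products of
  padded blocks are the padded products of the blocks.
\<close>

definition subvec :: "'d set \<Rightarrow> real ^ 'd \<Rightarrow> real ^ 'd" where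
  "subvec b x = (\<chi> i. if i \<in> b then x $ i else 0)"

definition submat :: "'d set \<Rightarrow> 'd set \<Rightarrow> real ^ 'd ^ 'd \<Rightarrow> real ^ 'd ^ 'd" where
  "submat b b' V = (\<chi> i j. if i \<in> b \<and> j \<in> b' then V $ i $ j else 0)"

text \<open>
  The inverse of the block $V_{bb}$ as a \<open>b \<times> b\<close> matrix, in padded form, so
  $\mathrm{diag}(V_{bb}^{-1}, 0)$ when the indices in \<open>b\<close> are listed first. The unit of the
  padded \<open>b \<times> b\<close> matrices is \<open>submat b b (mat 1)\<close>. As for \<^const>\<open>matrix_inv\<close>, the value is
  unspecified if the block is not invertible.
\<close>

definition submat_inv :: "'d set \<Rightarrow> real ^ 'd ^ 'd \<Rightarrow> real ^ 'd ^ 'd" where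
  "submat_inv b V = (SOME W. submat b b W = W \<and>
     submat b b V ** W = submat b b (mat 1) \<and> W ** submat b b V = submat b b (mat 1))"

lemma submat_inv_empty: "submat_inv {} V = 0"
proof -
  have "submat {} {} A = 0" for A :: "real ^ 'd ^ 'd"
    by (simp add: submat_def vec_eq_iff)
  then show ?thesis
    unfolding submat_inv_def by (intro some_equality) (auto simp: matrix_matrix_mult_def vec_eq_iff)
qed


definition partial_deriv :: "'d \<Rightarrow> (real ^ 'd \<Rightarrow> real) \<Rightarrow> real ^ 'd \<Rightarrow> real" where
  "partial_deriv j g t = deriv (\<lambda>s. g (t + s *\<^sub>R axis j 1)) 0"

definition partially_differentiable :: "'d \<Rightarrow> (real ^ 'd \<Rightarrow> real) \<Rightarrow> real ^ 'd \<Rightarrow> bool" where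
  "partially_differentiable j g t \<longleftrightarrow> (\<lambda>s. g (t + s *\<^sub>R axis j 1)) differentiable (at 0)"

definition hessian :: "(real ^ 'd \<Rightarrow> real) \<Rightarrow> real ^ 'd \<Rightarrow> real ^ 'd ^ 'd" where
  "hessian g t = (\<chi> i j. partial_deriv i (partial_deriv j g) t)"

text \<open>
  The second partial derivatives of $\log f$ at \<open>\<theta>\<close> exist. Positivity of the density near \<open>\<theta>\<close> is
  required because \<^const>\<open>ln\<close> is a total function.
\<close>

definition has_loglik_hessian :: "(real ^ 'd \<Rightarrow> real) \<Rightarrow> real ^ 'd \<Rightarrow> bool" where
  "has_loglik_hessian g \<theta> \<longleftrightarrow>
     (\<forall>\<^sub>F t in nhds \<theta>. 0 < g t \<and> (\<forall>j. partially_differentiable j (\<lambda>s. ln (g s)) t)) \<and>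
     (\<forall>i j. partially_differentiable i (partial_deriv j (\<lambda>s. ln (g s))) \<theta>)"

text \<open>
  \<open>P\<close> is the probability under the parameter \<open>\<theta>\<close>, \<open>Y\<close> a single observation and
  \<open>f x \<theta>\<close> its density.
\<close>

definition fisher_information ::
    "'w measure \<Rightarrow> ('w \<Rightarrow> 'x) \<Rightarrow> ('x \<Rightarrow> real ^ 'd \<Rightarrow> real) \<Rightarrow> real ^ 'd \<Rightarrow> real ^ 'd ^ 'd" where
  "fisher_information P Y f \<theta> =
     (\<chi> i j. - (\<integral>\<omega>. hessian (\<lambda>t. ln (f (Y \<omega>) t)) \<theta> $ i $ j \<partial>P))"


text \<open>The observed values of $X_1, \ldots, X_n$; an estimator is a function of this tuple.\<close>

definition sample :: "(nat \<Rightarrow> 'w \<Rightarrow> 'x) \<Rightarrow> nat \<Rightarrow> 'w \<Rightarrow> nat \<Rightarrow> 'x" where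
  "sample X n \<omega> = (\<lambda>i\<in>{1..n}. X i \<omega>)"

definition is_mle ::
    "('x \<Rightarrow> real ^ 'd \<Rightarrow> real) \<Rightarrow> (real ^ 'd) set \<Rightarrow> nat \<Rightarrow> (nat \<Rightarrow> 'x) \<Rightarrow> real ^ 'd \<Rightarrow> bool" where
  "is_mle f \<Theta> n x t \<longleftrightarrow> t \<in> \<Theta> \<and> (\<forall>s\<in>\<Theta>. (\<Prod>i=1..n. f (x i) s) \<le> (\<Prod>i=1..n. f (x i) t))"


definition converges_in_prob ::
    "'w measure \<Rightarrow> (nat \<Rightarrow> 'w \<Rightarrow> 'a :: metric_space) \<Rightarrow> 'a \<Rightarrow> bool" where
  "converges_in_prob P Y y \<longleftrightarrow>
     (\<forall>n. Y n \<in> borel_measurable P) \<and>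
     (\<forall>\<epsilon>>0. (\<lambda>n. measure P {\<omega> \<in> space P. \<epsilon> < dist (Y n \<omega>) y}) \<longlonglongrightarrow> 0)"

definition converges_in_dist ::
    "'w measure \<Rightarrow> (nat \<Rightarrow> 'w \<Rightarrow> 'a :: topological_space) \<Rightarrow> 'a measure \<Rightarrow> bool" where
  "converges_in_dist P Y L \<longleftrightarrow>
     (\<forall>n. Y n \<in> borel_measurable P) \<and>
     (\<forall>g :: 'a \<Rightarrow> real. continuous_on UNIV g \<and> bounded (range g) \<longrightarrow>
        (\<lambda>n. \<integral>\<omega>. g (Y n \<omega>) \<partial>P) \<longlonglongrightarrow> (\<integral>y. g y \<partial>L))"

definition std_mvnormal :: "(real ^ 'd) measure" where
  "std_mvnormal = distr (PiM UNIV (\<lambda>_. std_normal_distribution)) borel (\<lambda>z. \<chi> i. z i)"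

text \<open>
  \<open>L\<close> is the law $N(m, S)$, that is, the law of $m + AZ$ with \<open>Z\<close> standard normal and $AA' = S$;
  the law does not depend on the choice of \<open>A\<close>. Singular \<open>S\<close> is allowed.
\<close>

definition is_mvnormal :: "(real ^ 'd) measure \<Rightarrow> real ^ 'd \<Rightarrow> real ^ 'd ^ 'd \<Rightarrow> bool" where
  "is_mvnormal L m S \<longleftrightarrow>
     (\<exists>A :: real ^ 'd ^ 'd. A ** transpose A = S \<and> L = distr std_mvnormal borel (\<lambda>z. m + A *v z))"

lemma is_mvnormal_zero_cov:
  fixes m :: "real ^ 'd"
  shows "is_mvnormal L m 0 \<longleftrightarrow> L = return borel m"
proof -
  have [measurable]: "(\<lambda>z. \<chi> i. z i) \<in> PiM UNIV (\<lambda>_. std_normal_distribution) \<rightarrow>\<^sub>M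
      (borel :: (real ^ 'd) measure)"
    by (subst borel_measurable_euclidean_space)
       (auto simp: Basis_vec_def inner_axis intro!: measurable_component_singleton)
  interpret Z: prob_space "PiM UNIV (\<lambda>_ :: 'd :: finite. std_normal_distribution)"
    by (intro prob_space_PiM prob_space_normal_density) simp
  interpret prob_space "std_mvnormal :: (real ^ 'd) measure"
    unfolding std_mvnormal_def by (rule Z.prob_space_distr) measurable
  have eq: "A = 0" if "A ** transpose A = 0" for A :: "real ^ 'd ^ 'd"
  proof -
    have "(\<Sum>j\<in>UNIV. A $ i $ j * A $ i $ j) = 0" for i
      using arg_cong[OF that, of "\<lambda>B. B $ i $ i"] by (simp add: matrix_matrix_mult_def transpose_def)
    then show ?thesis
      by (simp add: sum_nonneg_eq_0_iff vec_eq_iff)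
  qed
  have "distr (std_mvnormal :: (real ^ 'd) measure) borel (\<lambda>z. m) = return borel m"
    by (rule measure_eqI) (auto simp: emeasure_distr emeasure_space_1 indicator_def)
  then show ?thesis
    unfolding is_mvnormal_def by (auto dest!: eq intro!: exI[of _ "0 :: real ^ 'd ^ 'd"])
qed

definition converges_to_normal ::
    "'w measure \<Rightarrow> (nat \<Rightarrow> 'w \<Rightarrow> real ^ 'd) \<Rightarrow> real ^ 'd \<Rightarrow> real ^ 'd ^ 'd \<Rightarrow> bool" where
  "converges_to_normal P Y m S \<longleftrightarrow> (\<exists>L. is_mvnormal L m S \<and> converges_in_dist P Y L)"


text \<open>
  In the next three definitions, \<open>t\<close> is the value of the initial estimator $\hat\theta_n$, \<open>V\<close> that of
  $\hat V$, and \<open>a\<close> is the vector of thresholds.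
\<close>

definition check_est :: "real ^ 'd ^ 'd \<Rightarrow> 'd set \<Rightarrow> real ^ 'd \<Rightarrow> real ^ 'd \<Rightarrow> real ^ 'd" where
  "check_est V b c t =
     subvec b t + submat_inv b V *v (submat b (- b) V *v subvec (- b) (t - c))"

definition selected :: "real ^ 'd \<Rightarrow> real ^ 'd \<Rightarrow> real ^ 'd \<Rightarrow> 'd set" where
  "selected a c t = {j. \<bar>t $ j - c $ j\<bar> > a $ j}"

definition oracle_hodges ::
    "real ^ 'd \<Rightarrow> real ^ 'd \<Rightarrow> real ^ 'd \<Rightarrow> real ^ 'd ^ 'd \<Rightarrow> real ^ 'd" where
  "oracle_hodges a c t V =
     (let b = selected a c t in
      if b = UNIV then t
      else if b = {} then c
      else (\<chi> j. if j \<in> b then check_est V b c t $ j else c $ j))"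

end

theory Submission
  imports Defs
begin

text \<open>
  Write $Y_n = \sqrt n(\hat\theta_n - \theta)$ and $b = b(\theta)$. As $Y_n$ is tight,
  $\sqrt n \min_j a_{nj} \to \infty$ excludes a wrongly selected index outside $b$, and
  $\max_j a_{nj} \to 0$ a wrongly rejected one in $b$, so $b_n(c) = b$ with probability tending
  to 1. On this event the estimator equals $c$ outside $b$, and
  $\sqrt n(\tilde\theta_n(c) - \theta) = G(\hat V) Y_n$, where $G(V)$ has the rows
  $(I, V_{bb}^{-1} V_{b\bar b})$ in $b$ and zero rows outside. By Slutsky's theorem the limit is
  $G(V) N(0, V^{-1})$. With the padded inverse $W$ of $V_{bb}$ one has $G(V) = WV$, hence the
  covariance $W V V^{-1} V W = W V W = W$. That $V$ is symmetric and positive definite, so that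
  $V_{bb}$ is invertible, follows from $V^{-1}$ being the covariance matrix of a normal law.
\<close>

section \<open>Padded blocks and their inverses\<close>

lemma matrix_inv_unique:
  fixes A :: "real ^ 'd ^ 'd"
  assumes "A ** B = mat 1"
  shows "matrix_inv A = B"
proof -
  have "B ** A = mat 1"
    using assms by (rule matrix_left_right_inverse[THEN iffD1])
  with assms have inv: "A ** matrix_inv A = mat 1 \<and> matrix_inv A ** A = mat 1"
    unfolding matrix_inv_def by (rule someI[of "\<lambda>B. A ** B = mat 1 \<and> B ** A = mat 1", OF conjI])
  then have "matrix_inv A = matrix_inv A ** (A ** B)"
    by (simp add: assms)
  also have "\<dots> = B"
    by (simp add: matrix_mul_assoc inv)
  finally show ?thesis .
qed

lemma
  fixes A :: "real ^ 'd ^ 'd"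
  assumes "invertible A"
  shows matrix_inv_right: "A ** matrix_inv A = mat 1"
    and matrix_inv_left: "matrix_inv A ** A = mat 1"
  using assms matrix_inv_unique unfolding invertible_def by metis+

lemma matrix_add_rdistrib:
  fixes A B C :: "real ^ 'd ^ 'd"
  shows "(A + B) ** C = A ** C + B ** C"
  by (vector matrix_matrix_mult_def sum.distrib[symmetric] field_simps)

text \<open>Cauchy-Schwarz in each row. \<open>norm A\<close> is the Frobenius norm, which thus
  dominates the operator norm.\<close>

lemma norm_matrix_vector_mult_le:
  fixes A :: "real ^ 'n ^ 'm"
  shows "norm (A *v x) \<le> norm A * norm x"
proof -
  have "norm (A *v x) = L2_set (\<lambda>i. \<bar>(A $ i) \<bullet> x\<bar>) UNIV"
    by (simp add: norm_vec_def matrix_mult_dot)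
  also have "\<dots> \<le> L2_set (\<lambda>i. norm (A $ i) * norm x) UNIV"
    by (intro L2_set_mono Cauchy_Schwarz_ineq2) simp
  also have "\<dots> = norm A * norm x"
    unfolding norm_vec_def[of A] by (rule L2_set_left_distrib[symmetric]) simp
  finally show ?thesis .
qed

lemma continuous_on_det:
  fixes f :: "'a :: topological_space \<Rightarrow> real ^ 'd ^ 'd"
  assumes "continuous_on S f"
  shows "continuous_on S (\<lambda>x. det (f x))"
  unfolding det_def by (intro continuous_intros assms)

lemma continuous_on_matrix_mult:
  fixes f g :: "'a :: topological_space \<Rightarrow> real ^ 'd ^ 'd"
  assumes "continuous_on S f" "continuous_on S g"
  shows "continuous_on S (\<lambda>x. f x ** g x)"
  unfolding matrix_matrix_mult_def by (intro continuous_intros assms)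

lemma open_invertible: "open {A :: real ^ 'd ^ 'd. invertible A}"
proof -
  have "open {A :: real ^ 'd ^ 'd. det A \<noteq> 0}"
    by (intro open_Collect_neq continuous_on_det continuous_intros)
  then show ?thesis
    by (simp add: invertible_det_nz)
qed

text \<open>Column \<open>l\<close> of the inverse solves A x = e_l, so Cramer's rule applies. The
  entries become quotients of polynomials in the entries of \<open>A\<close>, from which continuity
  can be read off.\<close>

lemma matrix_inv_cramer:
  fixes A :: "real ^ 'd ^ 'd"
  assumes "invertible A"
  shows "matrix_inv A =
    (\<chi> k l. det (\<chi> i j. if j = k then axis l 1 $ i else A $ i $ j) / det A)"
proof -
  have "A *v (matrix_inv A *v axis l 1) = axis l 1" for l
    by (simp add: matrix_vector_mul_assoc matrix_inv_right assms)
  then have "matrix_inv A *v axis l 1 =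
      (\<chi> k. det (\<chi> i j. if j = k then axis l 1 $ i else A $ i $ j) / det A)" for l
    using assms by (simp add: cramer invertible_det_nz)
  moreover have "matrix_inv A *v axis l 1 = (\<chi> k. matrix_inv A $ k $ l)" for l
    by (simp add: vec_eq_iff matrix_vector_mult_def axis_def if_distrib[of "\<lambda>x. _ * x"] cong: if_cong)
  ultimately show ?thesis
    by (simp only: vec_eq_iff vec_lambda_beta simp_thms)
qed

lemma continuous_on_matrix_inv:
  "continuous_on {A. invertible A} (matrix_inv :: real ^ 'd ^ 'd \<Rightarrow> real ^ 'd ^ 'd)"
proof -
  \<comment> \<open>The case distinction is on indices only, never on \<open>A\<close>, so it does
    not disturb continuity.\<close>
  have entry: "continuous_on {A. invertible A}
      (\<lambda>A :: real ^ 'd ^ 'd. if j = k then c else A $ i $ j)" for i j k c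
    by (cases "j = k") (auto intro!: continuous_intros)
  have "continuous_on {A. invertible A} (\<lambda>A :: real ^ 'd ^ 'd.
      \<chi> k l. det (\<chi> i j. if j = k then axis l 1 $ i else A $ i $ j) / det A)"
    by (intro continuous_on_vec_lambda continuous_on_divide continuous_on_det entry
        continuous_on_id) (simp add: invertible_det_nz)
  then show ?thesis
    by (rule continuous_on_eq) (rule matrix_inv_cramer[symmetric], simp)
qed

text \<open>
  Applied to \<^const>\<open>matrix_inv\<close> and \<^const>\<open>submat_inv\<close>: where no inverse exists, their common
  value is \<^term>\<open>SOME x. False\<close>, independent of the matrix.
\<close>

lemma borel_measurable_continuous_on_or_const:
  fixes f :: "'a :: topological_space \<Rightarrow> 'b :: {second_countable_topology, real_normed_vector}"
  assumes "open A" "continuous_on A f" "\<And>x. x \<notin> A \<Longrightarrow> f x = k"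
  shows "f \<in> borel_measurable borel"
proof -
  have [measurable]: "A \<in> sets borel"
    using assms by simp
  have [measurable]: "(\<lambda>x. indicator A x *\<^sub>R f x) \<in> borel_measurable borel"
    using assms by (intro borel_measurable_continuous_on_indicator) auto
  have "(\<lambda>x. indicator A x *\<^sub>R f x + indicator (- A) x *\<^sub>R k) \<in> borel_measurable borel"
    by measurable
  also have "(\<lambda>x. indicator A x *\<^sub>R f x + indicator (- A) x *\<^sub>R k) = f"
    using assms by (auto simp: indicator_def fun_eq_iff)
  finally show ?thesis .
qed

text \<open>The estimate of the inverse of \<open>V\<close> may be singular on some samples, so
  measurability is required on all matrices and not only where inversion is continuous.\<close>

lemma borel_measurable_matrix_inv [measurable]:
  "(matrix_inv :: real ^ 'd ^ 'd \<Rightarrow> real ^ 'd ^ 'd) \<in> borel_measurable borel"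
proof (rule borel_measurable_continuous_on_or_const[OF open_invertible continuous_on_matrix_inv,
      where k = "SOME _. False"])
  fix A :: "real ^ 'd ^ 'd"
  assume "A \<notin> {A. invertible A}"
  then have "(\<lambda>B. A ** B = mat 1 \<and> B ** A = mat 1) = (\<lambda>_. False)"
    by (auto simp: invertible_def)
  then show "matrix_inv A = (SOME _. False)"
    by (simp only: matrix_inv_def)
qed

section \<open>Blocks as products with coordinate projections\<close>

abbreviation padded_one :: "'d set \<Rightarrow> real ^ 'd ^ 'd" where
  "padded_one b \<equiv> submat b b (mat 1)"

lemma padded_one_nth: "padded_one b $ i $ j = (if i = j then if i \<in> b then 1 else 0 else 0)"
  by (auto simp: submat_def mat_def)

lemma padded_one_mult: "padded_one b ** A = submat b UNIV A"
proof -
  have "(padded_one b ** A) $ i $ j = (if i \<in> b then A $ i $ j else 0)" for i j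
    by (simp add: matrix_matrix_mult_def padded_one_nth if_distribR if_distrib[of "\<lambda>x. x * _"]
        cong: if_cong)
  then show ?thesis
    by (simp add: vec_eq_iff) (simp add: submat_def)
qed

lemma mult_padded_one: "A ** padded_one b = submat UNIV b A"
proof -
  have "(A ** padded_one b) $ i $ j = (if j \<in> b then A $ i $ j else 0)" for i j
    by (simp add: matrix_matrix_mult_def padded_one_nth if_distrib[of "\<lambda>x. _ * x"] cong: if_cong)
  then show ?thesis
    by (simp add: vec_eq_iff) (simp add: submat_def)
qed

lemma padded_one_mult_vec: "padded_one b *v x = subvec b x"
proof -
  have "(padded_one b *v x) $ i = (if i \<in> b then x $ i else 0)" for i
    by (simp add: matrix_vector_mult_def padded_one_nth if_distrib[of "\<lambda>x. x * _"] cong: if_cong)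
  then show ?thesis
    by (simp add: vec_eq_iff subvec_def)
qed

lemma submat_submat: "submat b1 b2 (submat b3 b4 A) = submat (b1 \<inter> b3) (b2 \<inter> b4) A"
  by (auto simp: submat_def vec_eq_iff)

text \<open>\<open>padded_one b\<close> is the orthogonal projection onto the coordinates in
  \<open>b\<close>. In this form, block identities reduce to associativity, idempotence and
  orthogonality of projections.\<close>

lemma submat_eq_mult: "submat b b' A = padded_one b ** A ** padded_one b'"
  by (simp add: padded_one_mult mult_padded_one submat_submat)

lemma padded_one_idem: "padded_one b ** padded_one b = padded_one b"
  by (simp add: padded_one_mult submat_submat)

lemma padded_one_compl: "padded_one b + padded_one (- b) = mat 1"
  by (auto simp: submat_def vec_eq_iff mat_def)

lemma padded_one_orthogonal:
  "padded_one b ** padded_one (- b) = 0" "padded_one (- b) ** padded_one b = 0"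
  by (auto simp: padded_one_mult submat_submat vec_eq_iff) (auto simp: submat_def)

lemma transpose_padded_one: "transpose (padded_one b) = padded_one b"
  by (auto simp: submat_def vec_eq_iff mat_def transpose_def)

section \<open>Inverses of diagonal blocks\<close>

definition is_submat_inv :: "'d set \<Rightarrow> real ^ 'd ^ 'd \<Rightarrow> real ^ 'd ^ 'd \<Rightarrow> bool" where
  "is_submat_inv b V W \<longleftrightarrow> submat b b W = W \<and>
     submat b b V ** W = padded_one b \<and> W ** submat b b V = padded_one b"

text \<open>Since \<open>W\<close> is supported on \<open>b\<close>, it absorbs the projection
  standing between it and \<open>V\<close>. The inverse identities then involve the full matrix
  \<open>V\<close> next to \<open>W\<close>, which is the form needed for the weight and its
  covariance.\<close>

lemma is_submat_invD:
  assumes "is_submat_inv b V W"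
  shows "padded_one b ** W = W" "W ** padded_one b = W"
    "padded_one b ** V ** W = padded_one b" "W ** V ** padded_one b = padded_one b"
proof -
  have W: "padded_one b ** W ** padded_one b = W"
    using assms by (simp add: is_submat_inv_def submat_eq_mult[of b b W])
  show 1: "padded_one b ** W = W"
    by (subst (1 2) W[symmetric]) (simp add: matrix_mul_assoc padded_one_idem)
  show 2: "W ** padded_one b = W"
    by (subst (1 2) W[symmetric]) (simp add: padded_one_idem flip: matrix_mul_assoc)
  have "padded_one b ** V ** padded_one b ** W = padded_one b"
    "W ** (padded_one b ** V ** padded_one b) = padded_one b"
    using assms by (simp_all add: is_submat_inv_def submat_eq_mult[of b b V])
  then show "padded_one b ** V ** W = padded_one b" "W ** V ** padded_one b = padded_one b"
    by (simp add: 1 flip: matrix_mul_assoc, simp add: 2 matrix_mul_assoc)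
qed

lemma is_submat_inv_unique:
  assumes "is_submat_inv b V W" "is_submat_inv b V W'"
  shows "W = W'"
proof -
  have "W = W ** (submat b b V ** W')"
    using assms(2) is_submat_invD(2)[OF assms(1)] by (simp add: is_submat_inv_def)
  also have "\<dots> = W'"
    using assms(1) is_submat_invD(1)[OF assms(2)] by (simp add: is_submat_inv_def matrix_mul_assoc)
  finally show ?thesis .
qed

lemma submat_inv_eq_Eps: "submat_inv b V = Eps (is_submat_inv b V)"
  by (simp add: submat_inv_def is_submat_inv_def[abs_def])

lemma submat_inv_eqI: "is_submat_inv b V W \<Longrightarrow> submat_inv b V = W"
  unfolding submat_inv_eq_Eps by (rule some_equality) (auto intro: is_submat_inv_unique)

text \<open>
  $\mathrm{diag}(V_{bb}, I)$ is invertible exactly if $V_{bb}$ is. It reduces \<^const>\<open>submat_inv\<close> to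
  \<^const>\<open>matrix_inv\<close> at a fixed size.
\<close>

definition complete_block :: "'d set \<Rightarrow> real ^ 'd ^ 'd \<Rightarrow> real ^ 'd ^ 'd" where
  "complete_block b V = submat b b V + padded_one (- b)"

text \<open>The completed block commutes with the projection onto \<open>b\<close>, hence so does
  its inverse. The inverse is therefore block diagonal, and its part on \<open>b\<close> inverts the
  block of \<open>V\<close>.\<close>

lemma is_submat_inv_matrix_inv_complete_block:
  assumes "invertible (complete_block b V)"
  shows "is_submat_inv b V (submat b b (matrix_inv (complete_block b V)))"
proof -
  define Q where "Q = complete_block b V"
  define R where "R = matrix_inv Q"
  let ?I = "padded_one b"
  have QR: "Q ** R = mat 1" "R ** Q = mat 1"
    using assms by (simp_all add: Q_def R_def matrix_inv_right matrix_inv_left)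
  have IQ: "?I ** Q = submat b b V" and QI: "Q ** ?I = submat b b V"
    unfolding Q_def complete_block_def
    by (simp_all add: matrix_add_ldistrib matrix_add_rdistrib padded_one_orthogonal)
      (simp_all add: padded_one_mult mult_padded_one submat_submat)
  have RI: "R ** ?I = ?I ** R"
  proof -
    have "R ** ?I = R ** ?I ** Q ** R"
      by (simp add: QR flip: matrix_mul_assoc)
    also have "\<dots> = R ** (Q ** ?I) ** R"
      by (simp add: IQ QI flip: matrix_mul_assoc)
    also have "\<dots> = ?I ** R"
      by (simp add: QR matrix_mul_assoc)
    finally show ?thesis .
  qed
  have W: "submat b b R = ?I ** R"
    using RI by (simp add: submat_eq_mult[of b b R] padded_one_idem flip: matrix_mul_assoc)
      (simp add: matrix_mul_assoc padded_one_idem)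
  have "submat b b V ** (?I ** R) = ?I"
    by (simp add: RI[symmetric] IQ[symmetric] QR matrix_mul_assoc)
      (simp add: QR padded_one_idem flip: matrix_mul_assoc)
  moreover have "?I ** R ** submat b b V = ?I"
    by (simp add: QI[symmetric] QR matrix_mul_assoc)
      (simp add: QR padded_one_idem flip: matrix_mul_assoc)
  ultimately show ?thesis
    unfolding is_submat_inv_def R_def[symmetric] Q_def[symmetric]
    by (simp add: W submat_submat[of b b b b R, simplified, unfolded W])
qed

text \<open>Converse direction: diag(W, I) inverts diag(V_bb, I), as the mixed products vanish by
  disjoint supports. Outside this domain the choice in \<open>submat_inv\<close> is thus a choice
  from nothing.\<close>

lemma invertible_complete_block:
  assumes "is_submat_inv b V W"
  shows "invertible (complete_block b V)"
proof -
  note W = is_submat_invD[OF assms]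
  have "padded_one (- b) ** W = 0"
    by (subst W(1)[symmetric]) (simp add: matrix_mul_assoc padded_one_orthogonal)
  moreover have "submat b b V ** padded_one (- b) = 0"
    by (simp add: submat_eq_mult[of b b V] padded_one_orthogonal flip: matrix_mul_assoc)
  moreover have "submat b b V ** W = padded_one b"
    using assms by (simp add: is_submat_inv_def)
  ultimately have "complete_block b V ** (W + padded_one (- b)) = mat 1"
    unfolding complete_block_def
    by (simp add: matrix_add_ldistrib matrix_add_rdistrib padded_one_idem padded_one_compl)
  then show ?thesis
    using matrix_left_right_inverse invertible_def by blast
qed

lemma continuous_on_submat:
  "continuous_on S f \<Longrightarrow> continuous_on S (\<lambda>x. submat b b' (f x))"
  by (simp add: submat_eq_mult[of b b'] continuous_on_matrix_mult)

lemma continuous_on_complete_block: "continuous_on S (complete_block b)"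
  unfolding complete_block_def[abs_def] by (intro continuous_intros continuous_on_submat)

lemma open_invertible_complete_block: "open {V. invertible (complete_block b V)}"
  using open_vimage[OF open_invertible continuous_on_complete_block[of UNIV b]]
  by (simp add: vimage_def)

lemma continuous_on_submat_inv:
  "continuous_on {V. invertible (complete_block b V)} (submat_inv b)"
proof (rule continuous_on_eq)
  show "continuous_on {V. invertible (complete_block b V)}
      (\<lambda>V. submat b b (matrix_inv (complete_block b V)))"
    by (intro continuous_on_submat continuous_on_compose2[OF continuous_on_matrix_inv]
        continuous_on_complete_block) auto
qed (auto intro!: submat_inv_eqI[symmetric] is_submat_inv_matrix_inv_complete_block)

lemma borel_measurable_submat_inv [measurable]: "submat_inv b \<in> borel_measurable borel"
proof (rule borel_measurable_continuous_on_or_const[OF open_invertible_complete_block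
      continuous_on_submat_inv, where k = "SOME _. False"])
  fix V assume "V \<notin> {V. invertible (complete_block b V)}"
  then have "is_submat_inv b V = (\<lambda>_. False)"
    using invertible_complete_block by auto
  then show "submat_inv b V = (SOME _. False)"
    by (simp only: submat_inv_eq_Eps)
qed

section \<open>Symmetry and positive definiteness\<close>

text \<open>Kernel argument: a null vector \<open>x\<close> has no part outside \<open>b\<close>,
  and its part y in \<open>b\<close> satisfies y . V y = 0, so y = 0 by positivity.\<close>

lemma invertible_complete_block_posdef:
  assumes "\<And>x. x \<noteq> 0 \<Longrightarrow> 0 < x \<bullet> (V *v x)"
  shows "invertible (complete_block b V)"
proof -
  have "x = 0" if x: "complete_block b V *v x = 0" for x
  proof -
    have eq: "submat b b V *v x + subvec (- b) x = 0"
      using x by (simp add: complete_block_def matrix_vector_mult_add_rdistrib padded_one_mult_vec)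
    have sub: "submat b b V *v x = subvec b (V *v subvec b x)"
      by (simp add: submat_eq_mult[of b b V] padded_one_mult_vec flip: matrix_vector_mul_assoc)
    \<comment> \<open>The two summands of \<open>eq\<close> have disjoint supports, so each of them
      vanishes.\<close>
    have comp: "subvec (- b) x = 0"
      using eq by (auto simp: sub vec_eq_iff subvec_def split: if_splits)
    then have "subvec b (V *v subvec b x) = 0"
      using eq by (simp add: sub)
    moreover have "subvec b x \<bullet> (V *v subvec b x) = subvec b x \<bullet> subvec b (V *v subvec b x)"
      by (auto simp: inner_vec_def subvec_def intro!: sum.cong)
    ultimately have "subvec b x = 0"
      using assms[of "subvec b x"] by force
    with comp show "x = 0"
      by (auto simp: vec_eq_iff subvec_def split: if_splits)
  qed
  then show ?thesis
    by (simp add: invertible_left_inverse matrix_left_invertible_ker)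
qed

text \<open>With I the projection onto \<open>b\<close>, I V W = I transposes to W' V I = I. Both
  identities evaluate W' V W, one to W' and the other to W.\<close>

lemma transpose_is_submat_inv:
  assumes V: "transpose V = V" and "is_submat_inv b V W"
  shows "transpose W = W"
proof -
  note W = is_submat_invD[OF assms(2)]
  have 1: "transpose W ** V ** padded_one b = padded_one b"
    using arg_cong[OF W(3), of transpose]
    by (simp add: matrix_transpose_mul V transpose_padded_one matrix_mul_assoc)
  have 2: "transpose W ** padded_one b = transpose W"
    using arg_cong[OF W(1), of transpose] by (simp add: matrix_transpose_mul transpose_padded_one)
  have "transpose W = transpose W ** V ** W"
    using arg_cong[OF W(3), of "\<lambda>A. transpose W ** A"] by (simp add: 2 matrix_mul_assoc)
  also have "\<dots> = W"
    using arg_cong[OF 1, of "\<lambda>A. A ** W"] by (simp add: W(1) flip: matrix_mul_assoc)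
  finally show ?thesis .
qed

text \<open>A covariance matrix S = A A' is symmetric, hence so is its inverse. With y = S^{-1} x,
  the quadratic form x . y equals the squared norm of A' y, which cannot vanish since x = A (A'
  y).\<close>

lemma
  fixes A S :: "real ^ 'd ^ 'd"
  assumes "A ** transpose A = S" "invertible S"
  shows transpose_matrix_inv_gram: "transpose (matrix_inv S) = matrix_inv S"
    and posdef_matrix_inv_gram: "x \<noteq> 0 \<Longrightarrow> 0 < x \<bullet> (matrix_inv S *v x)"
proof -
  have "transpose S = S"
    using assms(1) by (metis matrix_transpose_mul transpose_transpose)
  then have "S ** transpose (matrix_inv S) = mat 1"
    by (metis assms(2) matrix_inv_left matrix_transpose_mul transpose_mat)
  then show "transpose (matrix_inv S) = matrix_inv S"
    using matrix_inv_unique by metis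
  assume "x \<noteq> 0"
  define y where "y = matrix_inv S *v x"
  \<comment> \<open>\<open>y v* A\<close> is A' y, so this is x = S y.\<close>
  have x: "x = A *v (y v* A)"
    by (metis assms matrix_inv_right matrix_vector_mul_assoc matrix_vector_mul_lid
        transpose_matrix_vector y_def)
  then have "y v* A \<noteq> 0"
    using \<open>x \<noteq> 0\<close> by auto
  moreover have "x \<bullet> y = (y v* A) \<bullet> (y v* A)"
    by (subst x) (simp add: dot_lmul_matrix inner_commute)
  ultimately show "0 < x \<bullet> (matrix_inv S *v x)"
    by (simp add: y_def)
qed

section \<open>Normal limits and Slutsky's theorem\<close>

lemma borel_measurable_vec_lambda:
  fixes f :: "'i :: finite \<Rightarrow> 'a \<Rightarrow> 'b :: euclidean_space"
  assumes [measurable]: "\<And>i. f i \<in> borel_measurable M"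
  shows "(\<lambda>x. \<chi> i. f i x) \<in> borel_measurable M"
  by (subst borel_measurable_euclidean_space) (auto simp: Basis_vec_def inner_axis)

lemma borel_measurable_matrix_vector_mult:
  fixes f :: "'a \<Rightarrow> real ^ 'n ^ 'm"
  assumes "f \<in> borel_measurable M" "g \<in> borel_measurable M"
  shows "(\<lambda>x. f x *v g x) \<in> borel_measurable M"
proof -
  have "continuous_on UNIV (\<lambda>p :: (real ^ 'n ^ 'm) \<times> (real ^ 'n). fst p *v snd p)"
    unfolding matrix_vector_mult_def by (intro continuous_intros)
  then show ?thesis
    by (rule borel_measurable_continuous_Pair[OF assms])
qed

lemma sets_std_mvnormal [measurable_cong]: "sets (std_mvnormal :: (real ^ 'd) measure) = sets borel"
  by (simp add: std_mvnormal_def)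

lemma prob_space_std_mvnormal: "prob_space (std_mvnormal :: (real ^ 'd) measure)"
proof -
  have "(\<lambda>z. \<chi> i. z i) \<in> PiM UNIV (\<lambda>_. std_normal_distribution) \<rightarrow>\<^sub>M
      (borel :: (real ^ 'd) measure)"
    by (rule borel_measurable_vec_lambda) (auto intro!: measurable_component_singleton)
  moreover have "prob_space (PiM UNIV (\<lambda>_ :: 'd :: finite. std_normal_distribution))"
    by (intro prob_space_PiM prob_space_normal_density) simp
  ultimately show ?thesis
    unfolding std_mvnormal_def by (intro prob_space.prob_space_distr)
qed

lemma borel_measurable_affine_matrix [measurable]:
  "(\<lambda>z. m + A *v z) \<in> borel_measurable borel" for A :: "real ^ 'd ^ 'd"
  by (intro borel_measurable_continuous_onI continuous_intros)

lemma
  fixes S :: "real ^ 'd ^ 'd"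
  assumes "is_mvnormal L m S"
  shows prob_space_mvnormal: "prob_space L"
    and sets_mvnormal: "sets L = sets borel"
  using assms unfolding is_mvnormal_def
  by (auto intro!: prob_space.prob_space_distr[OF prob_space_std_mvnormal])

text \<open>If \<open>L\<close> is the law of A Z, the image is the law of (B A) Z, and B A is a
  factor of B S B'. Arguing with factors instead of densities covers singular \<open>B\<close>, such
  as a weight with zero rows.\<close>

lemma is_mvnormal_distr_matrix:
  fixes B S :: "real ^ 'd ^ 'd"
  assumes "is_mvnormal L 0 S"
  shows "is_mvnormal (distr L borel ((*v) B)) 0 (B ** S ** transpose B)"
proof -
  obtain A :: "real ^ 'd ^ 'd" where
    A: "A ** transpose A = S" "L = distr std_mvnormal borel (\<lambda>z. 0 + A *v z)"
    using assms unfolding is_mvnormal_def by blast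
  have [measurable]: "(*v) B \<in> borel_measurable borel" "(*v) A \<in> borel_measurable borel"
    by (intro borel_measurable_continuous_onI continuous_intros)+
  have "distr L borel ((*v) B) = distr std_mvnormal borel (\<lambda>z. 0 + (B ** A) *v z)"
    by (simp add: A(2) distr_distr comp_def matrix_vector_mul_assoc)
  moreover have "(B ** A) ** transpose (B ** A) = B ** S ** transpose B"
    by (simp add: matrix_transpose_mul matrix_mul_assoc flip: A(1))
  ultimately show ?thesis
    unfolding is_mvnormal_def by blast
qed

section \<open>Tightness and Slutsky's theorem\<close>

text \<open>The single law \<open>L\<close> has a small tail by continuity from above; a continuous
  test function squeezed between two tail indicators carries the bound over to \<open>Y n\<close>
  for large \<open>n\<close>.\<close>

lemma converges_in_dist_tight:
  fixes Y :: "nat \<Rightarrow> 'w \<Rightarrow> 'a :: euclidean_space"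
  assumes P: "prob_space P" and L: "prob_space L" "sets L = sets borel"
    and Y: "converges_in_dist P Y L" and "0 < e"
  obtains K where "\<forall>\<^sub>F n in sequentially. measure P {\<omega> \<in> space P. K < norm (Y n \<omega>)} < e"
proof -
  interpret P: prob_space P by fact
  interpret L: prob_space L by fact
  note [measurable_cong] = L(2)
  have [measurable]: "Y n \<in> borel_measurable P" for n
    using Y by (simp add: converges_in_dist_def)
  have "(\<lambda>k. measure L {y \<in> space L. real k < norm y}) \<longlonglongrightarrow>
      measure L (\<Inter>k. {y \<in> space L. real k < norm y})"
    by (intro L.finite_Lim_measure_decseq) (auto simp: decseq_def)
  moreover have "(\<Inter>k. {y \<in> space L. real k < norm y}) = {}"
  proof -
    have "\<exists>k. \<not> real k < norm y" for y :: 'a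
      using reals_Archimedean2[of "norm y"] by (auto dest: less_asym)
    then show ?thesis
      by blast
  qed
  ultimately have "(\<lambda>k. measure L {y \<in> space L. real k < norm y}) \<longlonglongrightarrow> 0"
    by simp
  then have "\<forall>\<^sub>F k in sequentially. measure L {y \<in> space L. real k < norm y} < e"
    using \<open>0 < e\<close> by (rule order_tendstoD(2))
  then obtain k :: nat where k: "measure L {y \<in> space L. real k < norm y} < e"
    by (auto simp: eventually_sequentially)
  \<comment> \<open>A ramp rising from 0 at radius \<open>k\<close> to 1 at radius
    \<open>k + 1\<close>: it lies below the indicator of the tail beyond \<open>k\<close> and above
    that of the tail beyond \<open>k + 1\<close>.\<close>
  define g where "g y = min 1 (max 0 (norm y - k))" for y :: 'a
  have g: "continuous_on UNIV g" "bounded (range g)"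
    unfolding g_def[abs_def] by (auto intro!: continuous_intros boundedI[of _ 1])
  have [measurable]: "g \<in> borel_measurable borel"
    by (intro borel_measurable_continuous_onI g)
  have "(\<integral>y. g y \<partial>L) \<le> (\<integral>y. indicator {y \<in> space L. real k < norm y} y \<partial>L)"
    by (intro integral_mono L.integrable_const_bound[of _ 1])
      (auto simp: g_def indicator_def)
  also have "\<dots> < e"
    using k by simp
  finally have "\<forall>\<^sub>F n in sequentially. (\<integral>\<omega>. g (Y n \<omega>) \<partial>P) < e"
    using Y g unfolding converges_in_dist_def by (intro order_tendstoD(2)) auto
  then have "\<forall>\<^sub>F n in sequentially. measure P {\<omega> \<in> space P. real k + 1 < norm (Y n \<omega>)} < e"
  proof eventually_elim
    case (elim n)
    have "measure P {\<omega> \<in> space P. real k + 1 < norm (Y n \<omega>)} =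
        (\<integral>\<omega>. indicator {\<omega> \<in> space P. real k + 1 < norm (Y n \<omega>)} \<omega> \<partial>P)"
      by simp
    also have "\<dots> \<le> (\<integral>\<omega>. g (Y n \<omega>) \<partial>P)"
      by (intro integral_mono P.integrable_const_bound[of _ 1])
        (auto simp: g_def indicator_def)
    finally show ?case
      using elim by simp
  qed
  then show ?thesis
    by (rule that)
qed

text \<open>Continuous mapping and Slutsky in one. Test functions are merely continuous, so
  tightness is used to confine \<open>h (Y n)\<close> to a ball, on which the test function is
  uniformly continuous.\<close>

lemma converges_in_dist_slutsky:
  fixes Y :: "nat \<Rightarrow> 'w \<Rightarrow> 'a :: euclidean_space" and Z :: "nat \<Rightarrow> 'w \<Rightarrow> 'b :: euclidean_space"
  assumes P: "prob_space P" and L: "prob_space L" "sets L = sets borel"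
    and Y: "converges_in_dist P Y L" and h: "continuous_on UNIV h"
    and Z [measurable]: "\<And>n. Z n \<in> borel_measurable P"
    and diff: "converges_in_prob P (\<lambda>n \<omega>. Z n \<omega> - h (Y n \<omega>)) 0"
  shows "converges_in_dist P Z (distr L borel h)"
  unfolding converges_in_dist_def
proof (intro conjI allI impI Z, elim conjE)
  interpret P: prob_space P by fact
  note [measurable_cong] = L(2)
  have [measurable]: "Y n \<in> borel_measurable P" for n
    using Y by (simp add: converges_in_dist_def)
  have [measurable]: "h \<in> borel_measurable borel"
    by (intro borel_measurable_continuous_onI h)
  fix g :: "'b \<Rightarrow> real"
  assume g: "continuous_on UNIV g" and bd: "bounded (range g)"
  have [measurable]: "g \<in> borel_measurable borel"
    by (intro borel_measurable_continuous_onI g)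
  obtain B where "0 < B" and B: "\<And>x. \<bar>g x\<bar> \<le> B"
    using bd by (auto simp: bounded_pos)
  \<comment> \<open>Continuous mapping: the composition of \<open>g\<close> with \<open>h\<close> is
    itself an admissible test function for \<open>Y\<close>.\<close>
  have "(\<lambda>n. \<integral>\<omega>. g (h (Y n \<omega>)) \<partial>P) \<longlonglongrightarrow> (\<integral>y. g (h y) \<partial>L)"
  proof -
    have "continuous_on UNIV (\<lambda>y. g (h y))" "bounded (range (\<lambda>y. g (h y)))"
      using bd by (auto intro: continuous_on_compose2[OF g h] elim: bounded_subset)
    then show ?thesis
      using Y unfolding converges_in_dist_def by blast
  qed
  moreover have "(\<integral>y. g (h y) \<partial>L) = (\<integral>y. g y \<partial>distr L borel h)"
    by (subst integral_distr) simp_all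
  moreover have "(\<lambda>n. (\<integral>\<omega>. g (Z n \<omega>) \<partial>P) - (\<integral>\<omega>. g (h (Y n \<omega>)) \<partial>P)) \<longlonglongrightarrow> 0"
  proof (rule LIMSEQ_I)
    fix e :: real assume "0 < e"
    \<comment> \<open>Error budget: at most \<open>\<eta>\<close> on the good event, and at most
      \<open>2 * B\<close> on each of two bad events of probability below \<open>\<eta>\<close>, in
      total less than \<open>e\<close>.\<close>
    define \<eta> where "\<eta> = e / (1 + 4 * B)"
    have "0 < \<eta>" "\<eta> * (1 + 4 * B) = e"
      using \<open>0 < e\<close> \<open>0 < B\<close> by (simp_all add: \<eta>_def)
    then have \<eta>: "0 < \<eta>" "\<eta> + 2 * B * (\<eta> + \<eta>) = e"
      by (simp_all add: algebra_simps)
    obtain K where K: "\<forall>\<^sub>F n in sequentially. measure P {\<omega> \<in> space P. K < norm (Y n \<omega>)} < \<eta>"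
      using converges_in_dist_tight[OF P L Y \<eta>(1)] .
    have "compact (h ` cball 0 K)"
      by (intro compact_continuous_image continuous_on_subset[OF h]) auto
    then obtain R where R: "\<And>y. norm y \<le> K \<Longrightarrow> norm (h y) \<le> R"
      by (metis bounded_iff compact_imp_bounded image_eqI mem_cball_0)
    \<comment> \<open>\<open>h (Y n)\<close> stays within radius \<open>R\<close>, and
      \<open>Z n\<close> is at distance at most 1 from it.\<close>
    have "uniformly_continuous_on (cball 0 (R + 1)) g"
      by (intro compact_uniformly_continuous continuous_on_subset[OF g]) auto
    then obtain d where "0 < d" and d: "\<And>x y. norm x \<le> R + 1 \<Longrightarrow> norm y \<le> R + 1 \<Longrightarrow>
        dist x y < d \<Longrightarrow> dist (g x) (g y) < \<eta>"
      unfolding uniformly_continuous_on_def using \<eta>(1) by (metis mem_cball_0)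
    \<comment> \<open>Off the event \<open>\<delta> < norm (Z n \<omega> - h (Y n \<omega>))\<close>
      the bound is only non-strict; halving \<open>d\<close> restores strictness, and the cap 1
      keeps \<open>Z n\<close> in the ball of radius \<open>R + 1\<close>.\<close>
    define \<delta> where "\<delta> = min 1 (d / 2)"
    have \<delta>: "0 < \<delta>" "\<delta> < d" "\<delta> \<le> 1"
      using \<open>0 < d\<close> by (auto simp: \<delta>_def)
    let ?S = "\<lambda>n. {\<omega> \<in> space P. K < norm (Y n \<omega>)}"
    let ?T = "\<lambda>n. {\<omega> \<in> space P. \<delta> < norm (Z n \<omega> - h (Y n \<omega>))}"
    have ST: "?S n \<in> sets P" "?T n \<in> sets P" for n
      by measurable
    have ind: "integrable P (indicat_real (?S n))" "integrable P (indicat_real (?T n))" for n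
      using ST by (auto simp: less_top[symmetric])
    have pt: "\<bar>g (Z n \<omega>) - g (h (Y n \<omega>))\<bar>
        \<le> \<eta> + 2 * B * (indicator (?S n) \<omega> + indicator (?T n) \<omega>)" if "\<omega> \<in> space P" for n \<omega>
    proof (cases "\<omega> \<in> ?S n \<union> ?T n")
      case True
      have "\<bar>g (Z n \<omega>) - g (h (Y n \<omega>))\<bar> \<le> 2 * B * 1"
        using B[of "Z n \<omega>"] B[of "h (Y n \<omega>)"] by linarith
      also have "\<dots> \<le> 2 * B * (indicator (?S n) \<omega> + indicator (?T n) \<omega>)"
        using True \<open>0 < B\<close> by (intro mult_left_mono) (auto simp: indicator_def)
      finally show ?thesis
        using \<eta>(1) by simp
    next
      case False
      then have "norm (Y n \<omega>) \<le> K" and Zh: "norm (Z n \<omega> - h (Y n \<omega>)) \<le> \<delta>"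
        using that by auto
      then have hR: "norm (h (Y n \<omega>)) \<le> R"
        using R by blast
      moreover have "norm (Z n \<omega>) \<le> norm (h (Y n \<omega>)) + norm (Z n \<omega> - h (Y n \<omega>))"
        by (metis add.commute diff_add_cancel norm_triangle_ineq)
      ultimately have "dist (g (Z n \<omega>)) (g (h (Y n \<omega>))) < \<eta>"
        using Zh \<delta> by (intro d) (auto simp: dist_norm)
      with False show ?thesis
        by (simp add: dist_real_def)
    qed
    have "(\<lambda>n. measure P (?T n)) \<longlonglongrightarrow> 0"
      using diff \<delta>(1) by (simp add: converges_in_prob_def)
    then have "\<forall>\<^sub>F n in sequentially. measure P (?T n) < \<eta>"
      using \<eta>(1) by (rule order_tendstoD(2))
    with K have "\<forall>\<^sub>F n in sequentially.
        \<bar>(\<integral>\<omega>. g (Z n \<omega>) \<partial>P) - (\<integral>\<omega>. g (h (Y n \<omega>)) \<partial>P)\<bar> < e"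
    proof eventually_elim
      case (elim n)
      have int: "integrable P (\<lambda>\<omega>. g (Z n \<omega>))" "integrable P (\<lambda>\<omega>. g (h (Y n \<omega>)))"
        using B by (auto intro!: P.integrable_const_bound[of _ B])
      have "\<bar>(\<integral>\<omega>. g (Z n \<omega>) \<partial>P) - (\<integral>\<omega>. g (h (Y n \<omega>)) \<partial>P)\<bar>
          \<le> (\<integral>\<omega>. \<bar>g (Z n \<omega>) - g (h (Y n \<omega>))\<bar> \<partial>P)"
        using int integral_abs_bound[of P "\<lambda>\<omega>. g (Z n \<omega>) - g (h (Y n \<omega>))"] by simp
      also have "\<dots> \<le> (\<integral>\<omega>. \<eta> + 2 * B * (indicator (?S n) \<omega> + indicator (?T n) \<omega>) \<partial>P)"
        using int ind by (intro integral_mono pt) auto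
      also have "\<dots> = \<eta> + 2 * B * (measure P (?S n) + measure P (?T n))"
        using ind by (simp add: P.prob_space)
      also have "\<dots> < \<eta> + 2 * B * (\<eta> + \<eta>)"
        using elim \<open>0 < B\<close> by (intro add_strict_left_mono mult_strict_left_mono) auto
      finally show ?case
        using \<eta>(2) by simp
    qed
    then show "\<exists>N. \<forall>n\<ge>N. norm ((\<integral>\<omega>. g (Z n \<omega>) \<partial>P) - (\<integral>\<omega>. g (h (Y n \<omega>)) \<partial>P) - 0) < e"
      by (simp add: eventually_sequentially)
  qed
  ultimately show "(\<lambda>n. \<integral>\<omega>. g (Z n \<omega>) \<partial>P) \<longlonglongrightarrow> (\<integral>y. g y \<partial>distr L borel h)"
    using tendsto_add by fastforce
qed

text \<open>Off \<open>E n\<close> the difference is (G(M n) - G(m)) Y n, a factor tending to 0 in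
  probability times a tight one. Continuity of \<open>G\<close> at the single point \<open>m\<close>
  suits matrix inversion, and \<open>E n\<close> will be the event of a wrong selection.\<close>

lemma converges_in_prob_matrix_mult_diff:
  fixes Y :: "nat \<Rightarrow> 'w \<Rightarrow> real ^ 'd" and G :: "'m :: {second_countable_topology, metric_space} \<Rightarrow> real ^ 'd ^ 'k"
  assumes P: "prob_space P" and L: "prob_space L" "sets L = sets borel"
    and Y: "converges_in_dist P Y L" and M: "converges_in_prob P M m" and G: "isCont G m"
    and Z [measurable]: "\<And>n. Z n \<in> borel_measurable P"
    and E [measurable]: "\<And>n. E n \<in> sets P" and E0: "(\<lambda>n. measure P (E n)) \<longlonglongrightarrow> 0"
    and ZY: "\<And>n \<omega>. \<omega> \<in> space P \<Longrightarrow> \<omega> \<notin> E n \<Longrightarrow> Z n \<omega> = G (M n \<omega>) *v Y n \<omega>"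
  shows "converges_in_prob P (\<lambda>n \<omega>. Z n \<omega> - G m *v Y n \<omega>) 0"
  unfolding converges_in_prob_def
proof (intro conjI allI impI)
  interpret P: prob_space P by fact
  have [measurable]: "Y n \<in> borel_measurable P" "M n \<in> borel_measurable P" for n
    using Y M by (simp_all add: converges_in_dist_def converges_in_prob_def)
  show D [measurable]: "(\<lambda>\<omega>. Z n \<omega> - G m *v Y n \<omega>) \<in> borel_measurable P" for n
    by (intro borel_measurable_diff borel_measurable_matrix_vector_mult) auto
  fix e :: real assume "0 < e"
  show "(\<lambda>n. measure P {\<omega> \<in> space P. e < dist (Z n \<omega> - G m *v Y n \<omega>) 0}) \<longlonglongrightarrow> 0"
  proof (rule order_tendstoI)
    fix r :: real assume "0 < r"
    \<comment> \<open>One third for each bad event: \<open>E n\<close>, a large \<open>Y n\<close>,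
      and \<open>M n\<close> far from \<open>m\<close>.\<close>
    then have r: "0 < r / 3" by simp
    obtain K where K: "\<forall>\<^sub>F n in sequentially. measure P {\<omega> \<in> space P. K < norm (Y n \<omega>)} < r / 3"
      using converges_in_dist_tight[OF P L Y r] .
    \<comment> \<open>Tightness gives no sign for \<open>K\<close>; \<open>\<bar>K\<bar> + 1\<close>
      is a positive bound of the norm in any case.\<close>
    have "0 < e / (\<bar>K\<bar> + 1)"
      using \<open>0 < e\<close> by simp
    then obtain d where "0 < d" and d: "\<And>x. dist x m < d \<Longrightarrow> dist (G x) (G m) < e / (\<bar>K\<bar> + 1)"
      using G unfolding continuous_at_eps_delta by blast
    let ?A = "\<lambda>n. {\<omega> \<in> space P. e < dist (Z n \<omega> - G m *v Y n \<omega>) 0}"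
    let ?S = "\<lambda>n. {\<omega> \<in> space P. K < norm (Y n \<omega>)}"
    let ?T = "\<lambda>n. {\<omega> \<in> space P. d / 2 < dist (M n \<omega>) m}"
    have ST: "?S n \<in> sets P" "?T n \<in> sets P" for n
      by measurable
    have sub: "?A n \<subseteq> E n \<union> ?S n \<union> ?T n" for n
    proof
      fix \<omega> assume "\<omega> \<in> ?A n"
      show "\<omega> \<in> E n \<union> ?S n \<union> ?T n"
      proof (rule ccontr)
        assume "\<omega> \<notin> E n \<union> ?S n \<union> ?T n"
        with \<open>\<omega> \<in> ?A n\<close> have "\<omega> \<notin> E n"
          and w: "\<omega> \<in> space P" "e < dist (Z n \<omega> - G m *v Y n \<omega>) 0"
            "\<not> d / 2 < dist (M n \<omega>) m" "\<not> K < norm (Y n \<omega>)"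
          by auto
        then have "norm (Z n \<omega> - G m *v Y n \<omega>) = norm ((G (M n \<omega>) - G m) *v Y n \<omega>)"
          using w(1) ZY by (simp add: matrix_vector_mult_diff_rdistrib)
        also have "\<dots> \<le> norm (G (M n \<omega>) - G m) * norm (Y n \<omega>)"
          by (rule norm_matrix_vector_mult_le)
        also have "\<dots> \<le> e / (\<bar>K\<bar> + 1) * (\<bar>K\<bar> + 1)"
          using d[of "M n \<omega>"] \<open>0 < d\<close> \<open>0 < e\<close> w(3,4)
          by (intro mult_mono) (auto simp: dist_norm)
        also have "\<dots> = e"
          by (simp add: field_simps)
        finally show False
          using w(2) by simp
      qed
    qed
    have "(\<lambda>n. measure P (?T n)) \<longlonglongrightarrow> 0"
      using M half_gt_zero[OF \<open>0 < d\<close>] unfolding converges_in_prob_def by blast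
    then have "\<forall>\<^sub>F n in sequentially. measure P (?T n) < r / 3"
      using r by (rule order_tendstoD(2))
    moreover have "\<forall>\<^sub>F n in sequentially. measure P (E n) < r / 3"
      using E0 r by (rule order_tendstoD(2))
    ultimately show "\<forall>\<^sub>F n in sequentially. measure P (?A n) < r"
      using K
    proof eventually_elim
      case (elim n)
      have "measure P (?A n) \<le> measure P (E n \<union> ?S n \<union> ?T n)"
        by (intro P.finite_measure_mono sub sets.Un E ST)
      also have "\<dots> \<le> measure P (E n) + measure P (?S n) + measure P (?T n)"
        by (intro order_trans[OF measure_Un_le] add_right_mono measure_Un_le sets.Un E ST)
      finally show ?case
        using elim by simp
    qed
  qed (auto intro!: always_eventually elim: less_le_trans)
qed

section \<open>The oracle Hodges estimator\<close>

text \<open>This is G(V), written with the blocks that the estimator itself uses. The leading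
  projection clears the rows outside \<open>b\<close> even where \<open>submat_inv\<close> is
  unspecified, as may happen at an estimated matrix.\<close>

definition hodges_weight :: "'d set \<Rightarrow> real ^ 'd ^ 'd \<Rightarrow> real ^ 'd ^ 'd" where
  "hodges_weight b V = padded_one b ** (mat 1 + submat_inv b V ** submat b (- b) V)"

text \<open>W V has the identity block in the columns of \<open>b\<close>, and W times the
  off-diagonal block in the other columns; the weight is the sum of these two halves.\<close>

lemma hodges_weight_eq:
  assumes "is_submat_inv b V W"
  shows "hodges_weight b V = W ** V"
proof -
  note W = is_submat_invD[OF assms]
  have "W ** submat b (- b) V = W ** V ** padded_one (- b)"
    by (simp add: submat_eq_mult[of b "- b" V] W(2) matrix_mul_assoc)
  then have "hodges_weight b V = W ** V ** padded_one b + W ** V ** padded_one (- b)"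
    by (simp add: hodges_weight_def submat_inv_eqI[OF assms] W matrix_add_ldistrib matrix_mul_assoc)
  then show ?thesis
    by (simp add: padded_one_compl flip: matrix_add_ldistrib)
qed

text \<open>The general branch covers both extreme cases: for the full index set the correction term
  multiplies a zero vector, and for the empty one only \<open>c\<close> remains.\<close>

lemma oracle_hodges_eq:
  "oracle_hodges a c t V =
     (\<chi> j. if j \<in> selected a c t then check_est V (selected a c t) c t $ j else c $ j)"
proof -
  have "check_est V UNIV c t = t"
    by (simp add: check_est_def subvec_def submat_def vec_eq_iff matrix_vector_mult_def)
  then show ?thesis
    by (simp add: oracle_hodges_def Let_def vec_eq_iff)
qed

text \<open>Outside \<open>b\<close> the centre \<open>c\<close> may be replaced by
  \<open>\<theta>\<close>, which makes the error linear in \<open>t - \<theta>\<close>. The identity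
  is exact and holds for every matrix \<open>V\<close>, so it applies to the estimated one.\<close>

lemma oracle_hodges_diff:
  assumes "selected a c t = b" "\<And>j. j \<notin> b \<Longrightarrow> \<theta> $ j = c $ j"
  shows "oracle_hodges a c t V - \<theta> = hodges_weight b V *v (t - \<theta>)"
proof -
  have "subvec (- b) (t - c) = subvec (- b) (t - \<theta>)"
    using assms(2) by (simp add: subvec_def vec_eq_iff)
  moreover have "submat b (- b) V *v subvec (- b) x = submat b (- b) V *v x" for x
    by (simp add: submat_eq_mult[of b "- b" V] matrix_vector_mul_assoc padded_one_idem
        flip: padded_one_mult_vec matrix_mul_assoc)
  ultimately have "check_est V b c t =
      subvec b t + (submat_inv b V ** submat b (- b) V) *v (t - \<theta>)"
    by (simp add: check_est_def matrix_vector_mul_assoc)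
  then have "hodges_weight b V *v (t - \<theta>) = subvec b (check_est V b c t - \<theta>)"
    unfolding hodges_weight_def
    by (simp add: matrix_vector_mult_add_rdistrib padded_one_mult_vec subvec_def vec_eq_iff
        flip: matrix_vector_mul_assoc)
  then show ?thesis
    using assms by (auto simp: oracle_hodges_eq vec_eq_iff subvec_def)
qed

text \<open>Deterministic part of selection consistency, with \<open>s\<close> to be sqrt n. An
  index wrongly selected deviates from its true value by more than the threshold; one wrongly
  rejected deviates, by the triangle inequality, by at least its distance to \<open>c\<close> minus
  the threshold.\<close>

lemma norm_gt_of_selected_neq:
  assumes "selected a c t \<noteq> {j. \<theta> $ j \<noteq> c $ j}"
    and "\<And>j. K < s * (a $ j)"
    and "\<And>j. \<theta> $ j \<noteq> c $ j \<Longrightarrow> K < s * (\<bar>\<theta> $ j - c $ j\<bar> - a $ j)"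
    and "0 \<le> s"
  shows "K < norm (s *\<^sub>R (t - \<theta>))"
proof -
  obtain j where "j \<in> selected a c t \<longleftrightarrow> \<theta> $ j = c $ j"
    using assms(1) by blast
  then have j: "(\<theta> $ j = c $ j \<and> a $ j < \<bar>t $ j - c $ j\<bar>)
      \<or> (\<theta> $ j \<noteq> c $ j \<and> \<bar>t $ j - c $ j\<bar> \<le> a $ j)"
    by (auto simp: selected_def)
  have le: "s * \<bar>t $ j - \<theta> $ j\<bar> \<le> norm (s *\<^sub>R (t - \<theta>))"
    using component_le_norm_cart[of "s *\<^sub>R (t - \<theta>)" j] \<open>0 \<le> s\<close>
    by (simp add: abs_mult)
  from j show ?thesis
  proof (elim disjE conjE)
    assume "\<theta> $ j = c $ j" "a $ j < \<bar>t $ j - c $ j\<bar>"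
    then have "s * (a $ j) \<le> s * \<bar>t $ j - \<theta> $ j\<bar>"
      using \<open>0 \<le> s\<close> by (intro mult_left_mono) auto
    with le assms(2)[of j] show ?thesis
      by simp
  next
    assume *: "\<theta> $ j \<noteq> c $ j" "\<bar>t $ j - c $ j\<bar> \<le> a $ j"
    then have "s * (\<bar>\<theta> $ j - c $ j\<bar> - a $ j) \<le> s * \<bar>t $ j - \<theta> $ j\<bar>"
      using \<open>0 \<le> s\<close> by (intro mult_left_mono) auto
    with le assms(3)[OF *(1)] show ?thesis
      by simp
  qed
qed

section \<open>Measurability of the estimator and consistency of the selection\<close>

lemma continuous_on_hodges_weight:
  "continuous_on {V. invertible (complete_block b V)} (hodges_weight b)"
  unfolding hodges_weight_def[abs_def]
  by (intro continuous_intros continuous_on_matrix_mult continuous_on_submat continuous_on_submat_inv)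

lemma measurable_selected:
  assumes [measurable]: "t \<in> borel_measurable M"
  shows "(\<lambda>\<omega>. selected a c (t \<omega>)) \<in> M \<rightarrow>\<^sub>M count_space UNIV"
proof (rule measurable_count_space_eq2[THEN iffD2])
  have [measurable]: "(\<lambda>\<omega>. t \<omega> $ j) \<in> borel_measurable M" for j
    using assms by (rule borel_measurable_continuous_on[rotated])
      (intro continuous_intros)
  have "{\<omega> \<in> space M. \<forall>j. (j \<in> b) = (a $ j < \<bar>t \<omega> $ j - c $ j\<bar>)} \<in> sets M" for b
    by measurable
  moreover have "(\<lambda>\<omega>. selected a c (t \<omega>)) -` {b} \<inter> space M =
      {\<omega> \<in> space M. \<forall>j. (j \<in> b) = (a $ j < \<bar>t \<omega> $ j - c $ j\<bar>)}" for b
    by (auto simp: selected_def set_eq_iff)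
  ultimately show "(\<lambda>\<omega>. selected a c (t \<omega>)) \<in> space M \<rightarrow> UNIV \<and>
      (\<forall>b\<in>UNIV. (\<lambda>\<omega>. selected a c (t \<omega>)) -` {b} \<inter> space M \<in> sets M)"
    by simp
qed simp

lemma borel_measurable_padded:
  shows borel_measurable_subvec: "subvec b \<in> borel_measurable borel"
    and borel_measurable_submat: "submat b b' \<in> borel_measurable borel"
proof -
  show "subvec b \<in> borel_measurable borel"
    by (intro borel_measurable_continuous_onI)
      (simp add: continuous_intros flip: padded_one_mult_vec)
  show "submat b b' \<in> borel_measurable borel"
    by (intro borel_measurable_continuous_onI continuous_on_submat continuous_on_id)
qed

text \<open>For a fixed index set the estimator is measurable, and the random index set takes
  finitely many values, so the branches can be glued.\<close>

lemma borel_measurable_oracle_hodges: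
  assumes [measurable]: "t \<in> borel_measurable M" "V \<in> borel_measurable M"
  shows "(\<lambda>\<omega>. oracle_hodges a c (t \<omega>) (V \<omega>)) \<in> borel_measurable M"
proof -
  note [measurable] = borel_measurable_padded borel_measurable_matrix_vector_mult
  have check [measurable]: "(\<lambda>\<omega>. check_est (V \<omega>) b c (t \<omega>)) \<in> borel_measurable M" for b
    unfolding check_est_def by measurable
  have nth: "(\<lambda>\<omega>. check_est (V \<omega>) b c (t \<omega>) $ j) \<in> borel_measurable M" for b j
    using check by (rule borel_measurable_continuous_on[rotated]) (intro continuous_intros)
  have "(\<lambda>\<omega>. \<chi> j. if j \<in> b then check_est (V \<omega>) b c (t \<omega>) $ j else c $ j) \<in> borel_measurable M" for b
    using nth by (intro borel_measurable_vec_lambda) simp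
  then show ?thesis
    unfolding oracle_hodges_eq
    by (rule measurable_compose_countable'[where I = UNIV and g = "\<lambda>\<omega>. selected a c (t \<omega>)"])
      (auto intro: countable_finite measurable_selected)
qed

text \<open>Tightness supplies one radius \<open>K\<close> that the scaled error exceeds with
  probability below \<open>r\<close>. For large \<open>n\<close> any wrong selection forces the
  error beyond \<open>K\<close>, so it is contained in this tail event.\<close>

lemma selection_consistent:
  fixes T :: "nat \<Rightarrow> 'w \<Rightarrow> real ^ 'd"
  assumes P: "prob_space P" and L: "prob_space L" "sets L = sets borel"
    and Y: "converges_in_dist P (\<lambda>n \<omega>. sqrt n *\<^sub>R (T n \<omega> - \<theta>)) L"
    and a_pos: "\<And>n j. 0 < a n $ j"
    and a_max: "(\<lambda>n. Max (range (\<lambda>j. a n $ j))) \<longlonglongrightarrow> 0"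
    and a_min: "filterlim (\<lambda>n. sqrt n * Min (range (\<lambda>j. a n $ j))) at_top sequentially"
  shows "(\<lambda>n. measure P {\<omega> \<in> space P. selected (a n) c (T n \<omega>) \<noteq> {j. \<theta> $ j \<noteq> c $ j}}) \<longlonglongrightarrow> 0"
proof (rule order_tendstoI)
  interpret P: prob_space P by fact
  have [measurable]: "(\<lambda>\<omega>. sqrt n *\<^sub>R (T n \<omega> - \<theta>)) \<in> borel_measurable P" for n
    using Y by (simp add: converges_in_dist_def)
  fix r :: real assume "0 < r"
  then obtain K where K: "\<forall>\<^sub>F n in sequentially.
      measure P {\<omega> \<in> space P. K < norm (sqrt n *\<^sub>R (T n \<omega> - \<theta>))} < r"
    using converges_in_dist_tight[OF P L Y] by blast
  have "\<forall>\<^sub>F n in sequentially. K < sqrt n * Min (range (\<lambda>j. a n $ j))"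
    using a_min by (simp add: filterlim_at_top_dense)
  then have 1: "\<forall>\<^sub>F n in sequentially. \<forall>j. K < sqrt n * (a n $ j)"
  proof eventually_elim
    case (elim n)
    have "sqrt n * Min (range (\<lambda>j. a n $ j)) \<le> sqrt n * (a n $ j)" for j
      by (intro mult_left_mono Min_le) auto
    with elim show ?case
      using less_le_trans by blast
  qed
  have "\<forall>\<^sub>F n in sequentially. \<theta> $ j \<noteq> c $ j \<longrightarrow> K < sqrt n * (\<bar>\<theta> $ j - c $ j\<bar> - a n $ j)" for j
  proof (cases "\<theta> $ j = c $ j")
    case False
    \<comment> \<open>The bracket below then tends to a positive limit, so its product with sqrt n
      diverges. The finitely many indices are combined afterwards.\<close>
    have "(\<lambda>n. a n $ j) \<longlonglongrightarrow> 0"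
      by (rule tendsto_sandwich[OF _ _ tendsto_const a_max])
        (auto intro!: always_eventually less_imp_le[OF a_pos] Max_ge)
    then have "(\<lambda>n. \<bar>\<theta> $ j - c $ j\<bar> - a n $ j) \<longlonglongrightarrow> \<bar>\<theta> $ j - c $ j\<bar> - 0"
      by (intro tendsto_intros)
    moreover have "filterlim (\<lambda>n. sqrt (real n)) at_top sequentially"
      by (rule filterlim_compose[OF sqrt_at_top filterlim_real_sequentially])
    ultimately have "filterlim (\<lambda>n. sqrt n * (\<bar>\<theta> $ j - c $ j\<bar> - a n $ j)) at_top sequentially"
      using False by (intro filterlim_at_top_mult_tendsto_pos) auto
    then show ?thesis
      by (auto simp: filterlim_at_top_dense elim: eventually_mono)
  qed simp
  then have "\<forall>\<^sub>F n in sequentially. \<forall>j. \<theta> $ j \<noteq> c $ j \<longrightarrow>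
      K < sqrt n * (\<bar>\<theta> $ j - c $ j\<bar> - a n $ j)"
    by (rule eventually_all_finite)
  with K 1 show "\<forall>\<^sub>F n in sequentially.
      measure P {\<omega> \<in> space P. selected (a n) c (T n \<omega>) \<noteq> {j. \<theta> $ j \<noteq> c $ j}} < r"
  proof eventually_elim
    case (elim n)
    have "measure P {\<omega> \<in> space P. selected (a n) c (T n \<omega>) \<noteq> {j. \<theta> $ j \<noteq> c $ j}}
        \<le> measure P {\<omega> \<in> space P. K < norm (sqrt n *\<^sub>R (T n \<omega> - \<theta>))}"
      using elim by (intro P.finite_measure_mono subsetI CollectI)
        (auto simp del: norm_scaleR intro: norm_gt_of_selected_neq)
    with elim show ?case
      by linarith
  qed
qed (auto intro!: always_eventually elim: less_le_trans)

section \<open>Asymptotics at a fixed parameter\<close>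

text \<open>What is consistently estimated is the inverse of V, so the weight is viewed as a
  function of it. Both domains of inversion are open, so continuity on them yields continuity at the
  point.\<close>

lemma isCont_hodges_weight_matrix_inv:
  assumes "invertible S" "invertible (complete_block b (matrix_inv S))"
  shows "isCont (\<lambda>M. hodges_weight b (matrix_inv M)) S"
proof (rule isCont_o2[where f = matrix_inv and g = "hodges_weight b"])
  show "isCont matrix_inv S"
    by (rule continuous_on_eq_continuous_at[THEN iffD1, OF open_invertible continuous_on_matrix_inv,
          rule_format]) (simp add: assms(1))
  show "isCont (hodges_weight b) (matrix_inv S)"
    by (rule continuous_on_eq_continuous_at[THEN iffD1, OF open_invertible_complete_block
          continuous_on_hodges_weight, rule_format]) (simp add: assms(2))
qed

lemma hodges_weight_covariance:
  assumes "is_submat_inv b V W" "transpose V = V" "V ** S = mat 1"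
  shows "hodges_weight b V ** S ** transpose (hodges_weight b V) = W"
proof -
  note W = is_submat_invD[OF assms(1)]
  have tW: "transpose W = W"
    using assms(2,1) by (rule transpose_is_submat_inv)
  have "hodges_weight b V ** S ** transpose (hodges_weight b V) = W ** (V ** S) ** (V ** W)"
    by (simp add: hodges_weight_eq[OF assms(1)] matrix_transpose_mul tW assms(2) matrix_mul_assoc)
  \<comment> \<open>The projection absorbed by \<open>W\<close> is made visible, so that the block
    identity for \<open>padded_one b ** V ** W\<close> applies.\<close>
  also have "\<dots> = W ** padded_one b ** V ** W"
    by (simp add: assms(3) W(2) matrix_mul_assoc)
  also have "\<dots> = W ** (padded_one b ** V ** W)"
    by (simp only: matrix_mul_assoc)
  also have "\<dots> = W"
    by (simp add: W)
  finally show ?thesis .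
qed

text \<open>Separates the limit argument from the sampling model: \<open>T n\<close> stands for the
  initial estimator and \<open>M n\<close> for the estimate of the inverse of \<open>V\<close>, both
  as random variables under one fixed law.\<close>

lemma oracle_hodges_asymptotics:
  fixes T :: "nat \<Rightarrow> 'w \<Rightarrow> real ^ 'd" and M :: "nat \<Rightarrow> 'w \<Rightarrow> real ^ 'd ^ 'd"
  assumes P: "prob_space P" and V: "invertible V"
    and T [measurable]: "\<And>n. T n \<in> borel_measurable P"
    and T_normal: "converges_to_normal P (\<lambda>n \<omega>. sqrt n *\<^sub>R (T n \<omega> - \<theta>)) 0 (matrix_inv V)"
    and M: "converges_in_prob P M (matrix_inv V)"
    and a: "\<And>n j. 0 < a n $ j"
      "(\<lambda>n. Max (range (\<lambda>j. a n $ j))) \<longlonglongrightarrow> 0"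
      "filterlim (\<lambda>n. sqrt n * Min (range (\<lambda>j. a n $ j))) at_top sequentially"
  shows "\<And>b. (\<And>j. j \<notin> b \<Longrightarrow> \<theta> $ j = c $ j) \<Longrightarrow>
      (\<lambda>n. measure P {\<omega> \<in> space P. \<forall>j\<in>- b.
        oracle_hodges (a n) c (T n \<omega>) (matrix_inv (M n \<omega>)) $ j = \<theta> $ j}) \<longlonglongrightarrow> 1"
    and "converges_to_normal P
      (\<lambda>n \<omega>. sqrt n *\<^sub>R (oracle_hodges (a n) c (T n \<omega>) (matrix_inv (M n \<omega>)) - \<theta>))
      0 (submat_inv {j. \<theta> $ j \<noteq> c $ j} V)"
proof -
  interpret P: prob_space P by fact
  define S where "S = matrix_inv V"
  define b0 where "b0 = {j. \<theta> $ j \<noteq> c $ j}"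
  define Y where "Y n \<omega> = sqrt n *\<^sub>R (T n \<omega> - \<theta>)" for n \<omega>
  define H where "H n \<omega> = oracle_hodges (a n) c (T n \<omega>) (matrix_inv (M n \<omega>))" for n \<omega>
  define E where "E n = {\<omega> \<in> space P. selected (a n) c (T n \<omega>) \<noteq> b0}" for n
  have [measurable]: "M n \<in> borel_measurable P" for n
    using M by (simp add: converges_in_prob_def)
  have H [measurable]: "H n \<in> borel_measurable P" for n
    unfolding H_def[abs_def] by (intro borel_measurable_oracle_hodges) measurable
  have "E n = space P - (\<lambda>\<omega>. selected (a n) c (T n \<omega>)) -` {b0} \<inter> space P" for n
    by (auto simp: E_def)
  then have E [measurable]: "E n \<in> sets P" for n
    using measurable_sets[OF measurable_selected[OF T], of "{b0}" "a n" c n] by auto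
  obtain L where L: "is_mvnormal L 0 S" "converges_in_dist P Y L"
    using T_normal unfolding converges_to_normal_def S_def[symmetric] Y_def[abs_def] by blast
  note L' = prob_space_mvnormal[OF L(1)] sets_mvnormal[OF L(1)]
  have E0: "(\<lambda>n. measure P (E n)) \<longlonglongrightarrow> 0"
    unfolding E_def b0_def by (rule selection_consistent[OF P L' L(2)[unfolded Y_def[abs_def]] a])
  have S: "V ** S = mat 1" "S ** V = mat 1"
    using V by (simp_all add: S_def matrix_inv_right matrix_inv_left)
  then have "invertible S" and SV: "matrix_inv S = V"
    by (auto simp: invertible_def intro: matrix_inv_unique)
  obtain A :: "real ^ 'd ^ 'd" where A: "A ** transpose A = S"
    using L(1) unfolding is_mvnormal_def by blast
  have V': "transpose V = V" "\<And>x. x \<noteq> 0 \<Longrightarrow> 0 < x \<bullet> (V *v x)"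
    using transpose_matrix_inv_gram[OF A \<open>invertible S\<close>]
      posdef_matrix_inv_gram[OF A \<open>invertible S\<close>] by (simp_all add: SV)
  have block: "invertible (complete_block b0 V)"
    using V'(2) by (rule invertible_complete_block_posdef)
  have W: "is_submat_inv b0 V (submat_inv b0 V)"
    using is_submat_inv_matrix_inv_complete_block[OF block] submat_inv_eqI by metis

  show "(\<lambda>n. measure P {\<omega> \<in> space P. \<forall>j\<in>- b. oracle_hodges (a n) c (T n \<omega>) (matrix_inv (M n \<omega>)) $ j = \<theta> $ j})
      \<longlonglongrightarrow> 1" if b: "\<And>j. j \<notin> b \<Longrightarrow> \<theta> $ j = c $ j" for b
    unfolding H_def[symmetric]
  proof (rule tendsto_sandwich[OF _ _ _ tendsto_const])
    have [measurable]: "(\<lambda>\<omega>. H n \<omega> $ j) \<in> borel_measurable P" for n j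
      using H by (rule borel_measurable_continuous_on[rotated]) (intro continuous_intros)
    \<comment> \<open>The assumption on \<open>b\<close> says that \<open>b0\<close> is contained in
      \<open>b\<close>. Off \<open>E n\<close> no index outside \<open>b\<close> is selected, so
      there the estimator equals \<open>c\<close>, and hence \<open>\<theta>\<close>,
      exactly.\<close>
    have "1 - measure P (E n) \<le> measure P {\<omega> \<in> space P. \<forall>j\<in>- b. H n \<omega> $ j = \<theta> $ j}" for n
    proof -
      have "space P - E n \<subseteq> {\<omega> \<in> space P. \<forall>j\<in>- b. H n \<omega> $ j = \<theta> $ j}"
        using b by (auto simp: E_def b0_def H_def oracle_hodges_eq)
      then have "measure P (space P - E n) \<le> measure P {\<omega> \<in> space P. \<forall>j\<in>- b. H n \<omega> $ j = \<theta> $ j}"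
        by (intro P.finite_measure_mono) measurable
      then show ?thesis
        by (simp add: P.prob_compl)
    qed
    then show "\<forall>\<^sub>F n in sequentially. 1 - measure P (E n)
        \<le> measure P {\<omega> \<in> space P. \<forall>j\<in>- b. H n \<omega> $ j = \<theta> $ j}"
      by simp
    show "(\<lambda>n. 1 - measure P (E n)) \<longlonglongrightarrow> 1"
      using tendsto_diff[OF tendsto_const E0, of 1] by simp
  qed simp

  \<comment> \<open>Still with the estimated weight; consistency replaces it by its limit in the
    next steps.\<close>
  have weight: "sqrt n *\<^sub>R (H n \<omega> - \<theta>) = hodges_weight b0 (matrix_inv (M n \<omega>)) *v Y n \<omega>"
    if "\<omega> \<in> space P" "\<omega> \<notin> E n" for n \<omega>
  proof -
    have "H n \<omega> - \<theta> = hodges_weight b0 (matrix_inv (M n \<omega>)) *v (T n \<omega> - \<theta>)"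
      unfolding H_def using that by (intro oracle_hodges_diff) (auto simp: E_def b0_def)
    then show ?thesis
      by (simp add: Y_def matrix_vector_mult_scaleR)
  qed
  have cont: "isCont (\<lambda>M. hodges_weight b0 (matrix_inv M)) S"
    using \<open>invertible S\<close> block by (intro isCont_hodges_weight_matrix_inv) (simp_all add: SV)
  have meas: "(\<lambda>\<omega>. sqrt n *\<^sub>R (H n \<omega> - \<theta>)) \<in> borel_measurable P" for n
    by measurable
  \<comment> \<open>The map from \<open>M\<close> to the weight is evaluated in the limit at
    \<open>S\<close>, whose inverse is \<open>V\<close>.\<close>
  have "converges_in_prob P
      (\<lambda>n \<omega>. sqrt n *\<^sub>R (H n \<omega> - \<theta>) - hodges_weight b0 V *v Y n \<omega>) 0"
    using converges_in_prob_matrix_mult_diff[OF P L' L(2) M[folded S_def] cont meas E E0 weight]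
    by (simp add: SV)
  then have "converges_in_dist P (\<lambda>n \<omega>. sqrt n *\<^sub>R (H n \<omega> - \<theta>))
      (distr L borel ((*v) (hodges_weight b0 V)))"
    by (intro converges_in_dist_slutsky[OF P L' L(2)] meas matrix_vector_mult_linear_continuous_on)
  moreover have "is_mvnormal (distr L borel ((*v) (hodges_weight b0 V))) 0 (submat_inv b0 V)"
    using is_mvnormal_distr_matrix[OF L(1), of "hodges_weight b0 V"]
    by (simp add: hodges_weight_covariance[OF W V'(1) S(1)])
  ultimately show "converges_to_normal P
      (\<lambda>n \<omega>. sqrt n *\<^sub>R (oracle_hodges (a n) c (T n \<omega>) (matrix_inv (M n \<omega>)) - \<theta>))
      0 (submat_inv {j. \<theta> $ j \<noteq> c $ j} V)"
    unfolding converges_to_normal_def H_def[symmetric] b0_def[symmetric] by blast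
qed

section \<open>Transfer to the statistical model\<close>

lemma measurable_sample:
  assumes "\<And>i. 1 \<le> i \<Longrightarrow> X i \<in> P \<rightarrow>\<^sub>M \<nu>"
  shows "sample X n \<in> P \<rightarrow>\<^sub>M PiM {1..n} (\<lambda>_. \<nu>)"
  unfolding sample_def[abs_def] using assms by (intro measurable_restrict) simp

theorem theorem2p4:
  fixes \<nu> :: "'x measure"
    and f :: "'x \<Rightarrow> real ^ 'd \<Rightarrow> real"
    and \<Theta> :: "(real ^ 'd) set"
    and P :: "real ^ 'd \<Rightarrow> 'w measure"
    and X :: "nat \<Rightarrow> 'w \<Rightarrow> 'x"
    and est :: "nat \<Rightarrow> (nat \<Rightarrow> 'x) \<Rightarrow> real ^ 'd"
    and Vinv_est :: "nat \<Rightarrow> (nat \<Rightarrow> 'x) \<Rightarrow> real ^ 'd ^ 'd"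
    and c :: "real ^ 'd"
    and a :: "nat \<Rightarrow> real ^ 'd"
  assumes base: "sigma_finite_measure \<nu>"
    and f_nonneg: "\<And>\<theta> x. \<theta> \<in> \<Theta> \<Longrightarrow> x \<in> space \<nu> \<Longrightarrow> 0 \<le> f x \<theta>"
    and prob: "\<And>\<theta>. \<theta> \<in> \<Theta> \<Longrightarrow> prob_space (P \<theta>)"
    and indep: "\<And>\<theta>. \<theta> \<in> \<Theta> \<Longrightarrow> prob_space.indep_vars (P \<theta>) (\<lambda>_. \<nu>) X {1..}"
    and density: "\<And>\<theta> i. \<theta> \<in> \<Theta> \<Longrightarrow> 1 \<le> i \<Longrightarrow>
          distributed (P \<theta>) \<nu> (X i) (\<lambda>x. ennreal (f x \<theta>))"
    and hessian_exists: "\<And>\<theta>. \<theta> \<in> \<Theta> \<Longrightarrow> AE \<omega> in P \<theta>. has_loglik_hessian (f (X 1 \<omega>)) \<theta>"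
    and hessian_integrable: "\<And>\<theta> i j. \<theta> \<in> \<Theta> \<Longrightarrow>
          integrable (P \<theta>) (\<lambda>\<omega>. hessian (\<lambda>t. ln (f (X 1 \<omega>) t)) \<theta> $ i $ j)"
    and fisher_invertible: "\<And>\<theta>. \<theta> \<in> \<Theta> \<Longrightarrow> invertible (fisher_information (P \<theta>) (X 1) f \<theta>)"
    and fisher_inv_continuous:
          "continuous_on \<Theta> (\<lambda>\<theta>. matrix_inv (fisher_information (P \<theta>) (X 1) f \<theta>))"
    and est_measurable: "\<And>n. est n \<in> borel_measurable (PiM {1..n} (\<lambda>_. \<nu>))"
    and est_mle: "\<And>\<theta>. \<theta> \<in> \<Theta> \<Longrightarrow>
          \<forall>\<^sub>F n in sequentially. AE \<omega> in P \<theta>. is_mle f \<Theta> n (sample X n \<omega>) (est n (sample X n \<omega>))"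
    and est_efficient: "\<And>\<theta>. \<theta> \<in> \<Theta> \<Longrightarrow>
          converges_to_normal (P \<theta>) (\<lambda>n \<omega>. sqrt n *\<^sub>R (est n (sample X n \<omega>) - \<theta>))
            0 (matrix_inv (fisher_information (P \<theta>) (X 1) f \<theta>))"
    and Vinv_est_measurable: "\<And>n. Vinv_est n \<in> borel_measurable (PiM {1..n} (\<lambda>_. \<nu>))"
    and Vinv_est_consistent: "\<And>\<theta>. \<theta> \<in> \<Theta> \<Longrightarrow>
          converges_in_prob (P \<theta>) (\<lambda>n \<omega>. Vinv_est n (sample X n \<omega>))
            (matrix_inv (fisher_information (P \<theta>) (X 1) f \<theta>))"
    and a_pos: "\<And>n j. 0 < a n $ j"
    and a_max: "(\<lambda>n. Max (range (\<lambda>j. a n $ j))) \<longlonglongrightarrow> 0"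
    and a_min: "filterlim (\<lambda>n. sqrt n * Min (range (\<lambda>j. a n $ j))) at_top sequentially"
  shows "\<forall>\<theta>\<in>\<Theta>.
    (\<forall>b. (\<forall>j\<in>- b. \<theta> $ j = c $ j) \<longrightarrow>
       (\<lambda>n. measure (P \<theta>) {\<omega> \<in> space (P \<theta>). \<forall>j\<in>- b.
          oracle_hodges (a n) c (est n (sample X n \<omega>)) (matrix_inv (Vinv_est n (sample X n \<omega>))) $ j
            = \<theta> $ j}) \<longlonglongrightarrow> 1) \<and>
    converges_to_normal (P \<theta>)
      (\<lambda>n \<omega>. sqrt n *\<^sub>R
         (oracle_hodges (a n) c (est n (sample X n \<omega>)) (matrix_inv (Vinv_est n (sample X n \<omega>))) - \<theta>))
      0 (submat_inv {j. \<theta> $ j \<noteq> c $ j} (fisher_information (P \<theta>) (X 1) f \<theta>))"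
proof (intro ballI)
  fix \<theta> assume \<theta>: "\<theta> \<in> \<Theta>"
  \<comment> \<open>Measurability of each observation is part of \<open>distributed\<close>, so
    every measurable function of the sample is a random variable under
    \<open>P \<theta>\<close>.\<close>
  have sample: "sample X n \<in> P \<theta> \<rightarrow>\<^sub>M PiM {1..n} (\<lambda>_. \<nu>)" for n
    using density[OF \<theta>] by (intro measurable_sample) (auto simp: distributed_def)
  have est: "(\<lambda>\<omega>. est n (sample X n \<omega>)) \<in> borel_measurable (P \<theta>)" for n
    using measurable_compose[OF sample est_measurable] .
  note asymptotics = oracle_hodges_asymptotics[OF prob fisher_invertible est est_efficient
      Vinv_est_consistent a_pos a_max a_min, OF \<theta> \<theta> \<theta> \<theta>]
  show "(\<forall>b. (\<forall>j\<in>- b. \<theta> $ j = c $ j) \<longrightarrow>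
       (\<lambda>n. measure (P \<theta>) {\<omega> \<in> space (P \<theta>). \<forall>j\<in>- b.
          oracle_hodges (a n) c (est n (sample X n \<omega>)) (matrix_inv (Vinv_est n (sample X n \<omega>))) $ j
            = \<theta> $ j}) \<longlonglongrightarrow> 1) \<and>
    converges_to_normal (P \<theta>)
      (\<lambda>n \<omega>. sqrt n *\<^sub>R
         (oracle_hodges (a n) c (est n (sample X n \<omega>)) (matrix_inv (Vinv_est n (sample X n \<omega>))) - \<theta>))
      0 (submat_inv {j. \<theta> $ j \<noteq> c $ j} (fisher_information (P \<theta>) (X 1) f \<theta>))"
    by (intro conjI allI impI asymptotics) auto
qed

end
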